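(* Let $K$ be a simplicial complex on $[m]$, let $n_1,\dots,n_m>0$, $s_0=0$, $s_k=n_1+\cdots+n_k$, $n=s_m$, and identify $[n_k]$ with the subset $\{s_{k-1}+1,\dots,s_k\}$ of $[n]$. For each $k=1,\dots,m$ let $(X_k,A_k)$ be a simplicial pair on $[n_k]$, and let $(\underline U,\underline C)=\{(U_i,C_i)\}_{i=1}^n$ be a sequence of topological pairs, with $(\underline{U_k},\underline{C_k})=\{(U_i,C_i)\}_{i=s_{k-1}+1}^{s_k}$. Define $$Y_k=\mathcal Z(X_k;\underline{U_k},\underline{C_k}),\qquad B_k=\mathcal Z(A_k;\underline{U_k},\underline{C_k}),\qquad (\underline Y,\underline B)=\{(Y_k,B_k)\}_{k=1}^m .$$ Then $$\mathcal Z(K;\underline Y,\underline B)=\mathcal Z(\mathcal S(K;\underline X,\underline A);\underline U,\underline C),$$ where $\mathcal S(K;\underline X,\underline A)$ is the polyhedral product complex of $K$ and $(\underline X,\underline A)=\{(X_k,A_k)\}_{k=1}^m$.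
   Context: $[m]=\{1,\dots,m\}$. A simplicial complex on a finite set $S$ is a set of subsets of $S$ closed under taking subsets; ghost vertices are allowed, and both $\{\emptyset\}$ and the void complex $\{\,\}$ (no simplices) are allowed. A simplicial pair on $[n_k]$ is a pair $(X_k,A_k)$ of simplicial complexes on $[n_k]$ with $A_k\subset X_k$. Polyhedral product space: for a simplicial complex $K$ on a finite index set $I$ and topological pairs $(X_i,A_i)$, $i\in I$ (empty spaces allowed), $\mathcal Z(K;\underline X,\underline A)=\bigcup_{\tau\in K}D(\tau)\subset\prod_{i\in I} X_i$, where $D(\tau)=\prod_i Y_i$ with $Y_i=X_i$ if $i\in\tau$ and $Y_i=A_i$ if $i\notin\tau$; $\mathcal Z(\{\,\};\underline X,\underline A)=\emptyset$. Join: for simplicial complexes $Y_k$ on $[n_k]$, $Y_1*\cdots*Y_m=\{\sigma\subset[n]\mid \sigma\cap[n_k]\in Y_k \text{ for } k=1,\dots,m\}$ (so it is $\{\,\}$ if some $Y_k=\{\,\}$). Polyhedral product complex: for $\tau\subset[m]$ let $S(\tau)=Y_1*\cdots*Y_m$ with $Y_k=X_k$ if $k\in\tau$ and $Y_k=A_k$ if $k\notin\tau$. Then $\mathcal S(K;\underline X,\underline A)=\bigcup_{\tau\in K}S(\tau)$, a simplicial complex on $[n]$; $\mathcal S(\{\,\};\underline X,\underline A)=\{\,\}$. *)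

theory Defs
  imports "HOL-Analysis.Analysis"
begin

section \<open>Simplicial complexes\<close>

text \<open>Neither the empty simplex nor the singletons are required to be simplices: ghost vertices,
  the complex \<open>{{}}\<close> and the void complex \<open>{}\<close> are all allowed.\<close>

definition abstract_simplicial_complex :: "'v set \<Rightarrow> 'v set set \<Rightarrow> bool" where
  "abstract_simplicial_complex S K \<longleftrightarrow>
     finite S \<and> (\<forall>\<sigma>\<in>K. \<sigma> \<subseteq> S) \<and> (\<forall>\<sigma>\<in>K. \<forall>\<rho>. \<rho> \<subseteq> \<sigma> \<longrightarrow> \<rho> \<in> K)"

definition simplicial_pair :: "'v set \<Rightarrow> 'v set set \<Rightarrow> 'v set set \<Rightarrow> bool" where
  "simplicial_pair S X A \<longleftrightarrow> abstract_simplicial_complex S X \<and> abstract_simplicial_complex S A \<and> A \<subseteq> X"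

text \<open>The vertex sets \<open>V k\<close> are meant to be pairwise disjoint.\<close>

definition simplicial_join :: "'k set \<Rightarrow> ('k \<Rightarrow> 'v set) \<Rightarrow> ('k \<Rightarrow> 'v set set) \<Rightarrow> 'v set set" where
  "simplicial_join I V Y = {\<sigma>. \<sigma> \<subseteq> (\<Union>k\<in>I. V k) \<and> (\<forall>k\<in>I. \<sigma> \<inter> V k \<in> Y k)}"

definition polyhedral_product_complex ::
    "'k set \<Rightarrow> ('k \<Rightarrow> 'v set) \<Rightarrow> 'k set set \<Rightarrow> ('k \<Rightarrow> 'v set set) \<Rightarrow> ('k \<Rightarrow> 'v set set) \<Rightarrow> 'v set set"
  where
  "polyhedral_product_complex I V K X A =
     (\<Union>\<tau>\<in>K. simplicial_join I V (\<lambda>k. if k \<in> \<tau> then X k else A k))"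

section \<open>Polyhedral product spaces\<close>

definition topological_pair :: "'a topology \<Rightarrow> 'a topology \<Rightarrow> bool" where
  "topological_pair X A \<longleftrightarrow> (\<exists>S \<subseteq> topspace X. A = subtopology X S)"

definition polyhedral_product ::
    "'i set \<Rightarrow> 'i set set \<Rightarrow> ('i \<Rightarrow> 'a topology) \<Rightarrow> ('i \<Rightarrow> 'a topology) \<Rightarrow> ('i \<Rightarrow> 'a) topology"
  where
  "polyhedral_product I K X A =
     subtopology (product_topology X I)
       (\<Union>\<tau>\<in>K. \<Pi>\<^sub>E i\<in>I. topspace (if i \<in> \<tau> then X i else A i))"

section \<open>Consecutive blocks of vertices\<close>

definition psum :: "(nat \<Rightarrow> nat) \<Rightarrow> nat \<Rightarrow> nat" where
  "psum n k = (\<Sum>j=1..k. n j)"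

text \<open>For \<open>k \<ge> 1\<close>, the copy of \<open>{1..n k}\<close> inside \<open>{1..psum n m}\<close>.\<close>

definition block :: "(nat \<Rightarrow> nat) \<Rightarrow> nat \<Rightarrow> nat set" where
  "block n k = {psum n (k - 1) + 1..psum n k}"

text \<open>For pairwise disjoint \<open>V k\<close>, the canonical identification of an iterated product
  \<open>\<Prod>k\<in>I. \<Prod>i\<in>V k. U i\<close> with \<open>\<Prod>i\<in>(\<Union>k\<in>I. V k). U i\<close>: the coordinate \<open>i \<in> V k\<close> of the
  image of \<open>f\<close> is \<open>f k i\<close>. It is a homeomorphism by \<open>homeomorphic_map_flatten\<close> below.\<close>

definition flatten :: "'k set \<Rightarrow> ('k \<Rightarrow> 'i set) \<Rightarrow> ('k \<Rightarrow> 'i \<Rightarrow> 'a) \<Rightarrow> 'i \<Rightarrow> 'a" where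
  "flatten I V f = (\<lambda>i \<in> (\<Union>k\<in>I. V k). f (THE k. k \<in> I \<and> i \<in> V k) i)"

section \<open>Basic facts\<close>

lemma topspace_polyhedral_product:
  assumes "\<And>i. i \<in> I \<Longrightarrow> topological_pair (X i) (A i)"
  shows "topspace (polyhedral_product I K X A) =
           (\<Union>\<tau>\<in>K. \<Pi>\<^sub>E i\<in>I. topspace (if i \<in> \<tau> then X i else A i))"
proof -
  have "(\<Pi>\<^sub>E i\<in>I. topspace (if i \<in> \<tau> then X i else A i)) \<subseteq> (\<Pi>\<^sub>E i\<in>I. topspace (X i))" for \<tau>
  proof (rule PiE_mono)
    fix i assume "i \<in> I"
    then have "topspace (A i) \<subseteq> topspace (X i)"
      using assms[of i] unfolding topological_pair_def by auto
    then show "topspace (if i \<in> \<tau> then X i else A i) \<subseteq> topspace (X i)"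
      by simp
  qed
  then show ?thesis
    unfolding polyhedral_product_def topspace_subtopology topspace_product_topology by blast
qed

lemma topological_pair_polyhedral_product:
  assumes "L \<subseteq> K"
  shows "topological_pair (polyhedral_product I K X A) (polyhedral_product I L X A)"
proof -
  let ?D = "\<lambda>K. \<Union>\<tau>\<in>K. \<Pi>\<^sub>E i\<in>I. topspace (if i \<in> \<tau> then X i else A i)"
  have sub: "?D L \<subseteq> ?D K"
    using assms by blast
  let ?S = "topspace (product_topology X I) \<inter> ?D L"
  have "?D K \<inter> ?S = ?S"
    using sub by blast
  then have "polyhedral_product I L X A = subtopology (polyhedral_product I K X A) ?S"
    unfolding polyhedral_product_def subtopology_subtopology by (simp only: subtopology_restrict)
  moreover have "?S \<subseteq> topspace (polyhedral_product I K X A)"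
    using sub unfolding polyhedral_product_def topspace_subtopology by blast
  ultimately show ?thesis
    unfolding topological_pair_def by blast
qed

lemma abstract_simplicial_complex_polyhedral_product_complex:
  assumes "finite I" and "\<And>k. k \<in> I \<Longrightarrow> simplicial_pair (V k) (X k) (A k)"
  shows "abstract_simplicial_complex (\<Union>k\<in>I. V k) (polyhedral_product_complex I V K X A)"
proof -
  have down: "\<rho> \<inter> V k \<in> (if k \<in> \<tau> then X k else A k)"
    if "k \<in> I" "\<sigma> \<inter> V k \<in> (if k \<in> \<tau> then X k else A k)" "\<rho> \<subseteq> \<sigma>" for k \<rho> \<sigma> \<tau>
  proof -
    have "\<rho> \<inter> V k \<subseteq> \<sigma> \<inter> V k"
      using that(3) by blast
    then show ?thesis
      using that(2) assms(2)[OF that(1)]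
      unfolding simplicial_pair_def abstract_simplicial_complex_def by (metis (full_types))
  qed
  have "finite (\<Union>k\<in>I. V k)"
    using assms by (auto simp: simplicial_pair_def abstract_simplicial_complex_def)
  moreover have "\<rho> \<in> polyhedral_product_complex I V K X A"
    if s: "\<sigma> \<in> polyhedral_product_complex I V K X A" and r: "\<rho> \<subseteq> \<sigma>" for \<rho> \<sigma>
  proof -
    from s obtain \<tau> where t: "\<tau> \<in> K" "\<sigma> \<subseteq> (\<Union>k\<in>I. V k)"
        "\<And>k. k \<in> I \<Longrightarrow> \<sigma> \<inter> V k \<in> (if k \<in> \<tau> then X k else A k)"
      unfolding polyhedral_product_complex_def simplicial_join_def by blast
    have "\<rho> \<in> simplicial_join I V (\<lambda>k. if k \<in> \<tau> then X k else A k)"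
      unfolding simplicial_join_def using t(2) r down[OF _ t(3) r] by blast
    with t(1) show ?thesis
      unfolding polyhedral_product_complex_def by blast
  qed
  moreover have "\<sigma> \<subseteq> (\<Union>k\<in>I. V k)" if "\<sigma> \<in> polyhedral_product_complex I V K X A" for \<sigma>
    using that unfolding polyhedral_product_complex_def simplicial_join_def by blast
  ultimately show ?thesis
    unfolding abstract_simplicial_complex_def by blast
qed

lemma psum_mono: "j \<le> k \<Longrightarrow> psum n j \<le> psum n k"
  unfolding psum_def by (intro sum_mono2) auto

lemma Union_block: "(\<Union>k\<in>{1..m}. block n k) = {1..psum n m}"
proof (induction m)
  case 0
  show ?case by (simp add: psum_def)
next
  case (Suc m)
  have "{1..Suc m} = insert (Suc m) {1..m}"
    by auto
  then have "(\<Union>k\<in>{1..Suc m}. block n k) = block n (Suc m) \<union> {1..psum n m}"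
    using Suc by simp
  also have "\<dots> = {1..psum n (Suc m)}"
    using psum_mono[of m "Suc m" n] by (auto simp: block_def)
  finally show ?case .
qed

lemma disjoint_block: "disjoint_family_on (block n) {1..m}"
proof -
  have "block n j \<inter> block n k = {}" if "j < k" for j k
  proof -
    from that have "psum n j \<le> psum n (k - 1)"
      by (intro psum_mono) auto
    then show ?thesis by (auto simp: block_def)
  qed
  then show ?thesis
    unfolding disjoint_family_on_def by (metis inf_commute linorder_neqE_nat)
qed

lemma flatten_apply:
  assumes "disjoint_family_on V I" "k \<in> I" "i \<in> V k"
  shows "flatten I V f i = f k i"
proof -
  have "(THE k. k \<in> I \<and> i \<in> V k) = k"
    using assms by (intro the_equality) (auto simp: disjoint_family_on_def)
  then show ?thesis
    using assms by (auto simp: flatten_def)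
qed

lemma homeomorphic_map_flatten:
  fixes U :: "'i \<Rightarrow> 'a topology" and V :: "'k \<Rightarrow> 'i set"
  assumes "disjoint_family_on V I"
  shows "homeomorphic_map (product_topology (\<lambda>k. product_topology U (V k)) I)
           (product_topology U (\<Union>k\<in>I. V k)) (flatten I V)"
    (is "homeomorphic_map ?P ?Q _")
proof -
  define g where "g = (\<lambda>h :: 'i \<Rightarrow> 'a. \<lambda>k\<in>I. restrict h (V k))"
  have "continuous_map ?P (U i) (\<lambda>f. flatten I V f i)" if "k \<in> I" "i \<in> V k" for k i
  proof -
    have "continuous_map ?P (U i) ((\<lambda>h. h i) \<circ> (\<lambda>f. f k))"
      by (rule continuous_map_compose[where X' = "product_topology U (V k)"])
        (use that in \<open>auto intro: continuous_map_product_projection\<close>)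
    then show ?thesis
      using that by (simp add: flatten_apply[OF assms] o_def)
  qed
  moreover have "flatten I V f \<in> extensional (\<Union>k\<in>I. V k)" for f :: "'k \<Rightarrow> 'i \<Rightarrow> 'a"
    by (simp add: flatten_def)
  ultimately have "continuous_map ?P ?Q (flatten I V)"
    unfolding continuous_map_componentwise by blast
  moreover have "continuous_map ?Q ?P g"
  proof -
    have "continuous_map ?Q (product_topology U (V k)) (\<lambda>h. restrict h (V k))" if "k \<in> I" for k
      unfolding continuous_map_componentwise using that
      by (auto intro!: continuous_map_product_projection)
    then show ?thesis
      unfolding g_def continuous_map_componentwise by (auto simp: extensional_def)
  qed
  moreover have "g (flatten I V f) = f" if "f \<in> topspace ?P" for f
  proof
    fix k
    show "g (flatten I V f) k = f k"
    proof (cases "k \<in> I")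
      case True
      then have "f k \<in> extensional (V k)"
        using that by (auto simp: PiE_iff)
      with True show ?thesis
        by (auto simp: g_def fun_eq_iff restrict_def flatten_apply[OF assms True] extensional_def)
    qed (use that in \<open>auto simp: g_def PiE_iff extensional_def\<close>)
  qed
  moreover have "flatten I V (g h) = h" if "h \<in> topspace ?Q" for h
  proof
    fix i
    show "flatten I V (g h) i = h i"
    proof (cases "i \<in> (\<Union>k\<in>I. V k)")
      case True
      then obtain k where "k \<in> I" "i \<in> V k" by blast
      then show ?thesis
        by (simp add: flatten_apply[OF assms] g_def)
    qed (use that in \<open>auto simp: flatten_def PiE_iff extensional_def\<close>)
  qed
  ultimately show ?thesis
    unfolding homeomorphic_map_maps homeomorphic_maps_def by blast
qed

end

theory Submission
  imports Defs
begin

text \<open>Both sides are subspaces of spaces that \<open>flatten\<close> identifies, namely the iterated product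
  \<open>\<Prod>k. \<Prod>i\<in>V k. U i\<close> and the product of all \<open>U i\<close>, where \<open>V k\<close> is
  the \<open>k\<close>-th block of vertices; so only the underlying sets have
  to be compared. A point \<open>x\<close> of \<open>\<Prod>i\<in>S. U i\<close> has a support, the set of \<open>i\<close> with
  \<open>x i \<notin> C i\<close>, and \<open>x\<close> lies in \<open>D(\<tau>)\<close> iff its support is contained in \<open>\<tau>\<close>. As a simplicial
  complex is closed under subsets, \<open>x\<close> lies in its polyhedral product iff the support of \<open>x\<close> is a
  simplex (\<open>in_topspace_polyhedral_product_iff\<close>). The support of \<open>flatten f\<close> meets \<open>V k\<close> in the
  support of \<open>f k\<close>. Hence, for a given \<open>\<tau> \<in> K\<close>, that support is a simplex of the join \<open>S(\<tau>)\<close> iff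
  each \<open>f k\<close> has its support in \<open>X k\<close> (if \<open>k \<in> \<tau>\<close>) or in \<open>A k\<close> (if \<open>k \<notin> \<tau>\<close>), which is to say
  that \<open>f\<close> lies in the piece \<open>D(\<tau>)\<close> built from the pairs \<open>(Y k, B k)\<close>.\<close>

text \<open>The support of a point \<open>x\<close>: the coordinates in \<open>S\<close> at which \<open>x\<close> leaves the
  subspaces \<open>C i\<close>.\<close>

definition support_off :: "'i set \<Rightarrow> ('i \<Rightarrow> 'a topology) \<Rightarrow> ('i \<Rightarrow> 'a) \<Rightarrow> 'i set" where
  "support_off S C x = {i \<in> S. x i \<notin> topspace (C i)}"

lemma in_topspace_polyhedral_product_iff:
  assumes L: "abstract_simplicial_complex S L"
    and pair: "\<And>i. i \<in> S \<Longrightarrow> topological_pair (U i) (C i)"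
  shows "x \<in> topspace (polyhedral_product S L U C) \<longleftrightarrow>
           x \<in> topspace (product_topology U S) \<and> support_off S C x \<in> L"
    (is "?l \<longleftrightarrow> ?r")
proof
  assume ?l
  then have x: "x \<in> topspace (product_topology U S)"
    by (simp add: polyhedral_product_def)
  have "x \<in> (\<Union>\<tau>\<in>L. \<Pi>\<^sub>E i\<in>S. topspace (if i \<in> \<tau> then U i else C i))"
    using \<open>?l\<close> topspace_polyhedral_product[of S U C L, OF pair] by simp
  then obtain \<tau> where "\<tau> \<in> L"
      and \<tau>: "x \<in> (\<Pi>\<^sub>E i\<in>S. topspace (if i \<in> \<tau> then U i else C i))"
    by blast
  have "support_off S C x \<subseteq> \<tau>"
    unfolding support_off_def using PiE_mem[OF \<tau>] by (smt (verit) mem_Collect_eq subsetI)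
  with \<open>\<tau> \<in> L\<close> L x show ?r
    unfolding abstract_simplicial_complex_def by blast
next
  assume r: ?r
  then have "x \<in> (\<Pi>\<^sub>E i\<in>S. topspace (if i \<in> support_off S C x then U i else C i))"
    by (auto simp: PiE_iff support_off_def)
  with r show ?l
    using topspace_polyhedral_product[of S U C L, OF pair] by blast
qed

lemma support_off_flatten:
  assumes "disjoint_family_on V I" "k \<in> I"
  shows "support_off (\<Union>k\<in>I. V k) C (flatten I V f) \<inter> V k = support_off (V k) C (f k)"
  using assms by (auto simp: support_off_def flatten_apply)

text \<open>If each \<open>Y k\<close> is a subspace of \<open>P k\<close>, then a polyhedral product of the \<open>Y k\<close> carries the
  subspace topology from the product of the \<open>P k\<close>. This reduces the comparison of two
  polyhedral products to one of their underlying sets.\<close>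

lemma polyhedral_product_subspaces:
  assumes "\<And>k. Y k = subtopology (P k) (T k)"
  shows "polyhedral_product I K Y B =
           subtopology (product_topology P I) (topspace (polyhedral_product I K Y B))"
proof -
  have "Y = (\<lambda>k. subtopology (P k) (T k))"
    using assms by (rule ext)
  then have eq: "product_topology Y I = subtopology (product_topology P I) (Pi\<^sub>E I T)"
    by (simp only: subtopology_product_topology)
  show ?thesis
    unfolding polyhedral_product_def eq subtopology_subtopology topspace_subtopology
    by (metis subtopology_restrict inf_assoc)
qed

theorem homeomorphic_map_flatten_polyhedral_product:
  fixes U C :: "'i \<Rightarrow> 'a topology" and V :: "'k \<Rightarrow> 'i set"
  assumes "finite I" and disj: "disjoint_family_on V I"
    and XA: "\<And>k. k \<in> I \<Longrightarrow> simplicial_pair (V k) (X k) (A k)"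
    and UC: "\<And>i. i \<in> (\<Union>k\<in>I. V k) \<Longrightarrow> topological_pair (U i) (C i)"
  shows "homeomorphic_map
           (polyhedral_product I K
              (\<lambda>k. polyhedral_product (V k) (X k) U C) (\<lambda>k. polyhedral_product (V k) (A k) U C))
           (polyhedral_product (\<Union>k\<in>I. V k) (polyhedral_product_complex I V K X A) U C)
           (flatten I V)"
    (is "homeomorphic_map (polyhedral_product I K ?Y ?B) ?Z (flatten I V)")
proof -
  let ?P = "product_topology (\<lambda>k. product_topology U (V k)) I"
  let ?Q = "product_topology U (\<Union>k\<in>I. V k)"
  let ?W = "polyhedral_product I K ?Y ?B"
  note hom = homeomorphic_map_flatten[OF disj, of U]
  have W: "?W = subtopology ?P (topspace ?W)"
    by (rule polyhedral_product_subspaces) (rule polyhedral_product_def)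
  have Z: "?Z = subtopology ?Q (topspace ?Z)"
    by (rule polyhedral_product_subspaces[where T = "\<lambda>i. topspace (U i)"]) simp
  have YB: "y \<in> topspace (if k \<in> \<tau> then ?Y k else ?B k) \<longleftrightarrow>
              y \<in> topspace (product_topology U (V k)) \<and>
              support_off (V k) C y \<in> (if k \<in> \<tau> then X k else A k)"
    if "k \<in> I" for k y \<tau>
  proof -
    have "\<And>i. i \<in> V k \<Longrightarrow> topological_pair (U i) (C i)"
      using UC that by blast
    with XA[OF that] show ?thesis
      unfolding simplicial_pair_def
      by (auto simp: in_topspace_polyhedral_product_iff simp del: topspace_product_topology)
  qed
  have W_iff: "f \<in> topspace ?W \<longleftrightarrow> f \<in> topspace ?P \<and>
      (\<exists>\<tau>\<in>K. \<forall>k\<in>I. support_off (V k) C (f k) \<in> (if k \<in> \<tau> then X k else A k))" for f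
  proof -
    have "f \<in> topspace ?W \<longleftrightarrow>
        (\<exists>\<tau>\<in>K. f \<in> (\<Pi>\<^sub>E k\<in>I. topspace (if k \<in> \<tau> then ?Y k else ?B k)))"
    proof (subst topspace_polyhedral_product)
      show "topological_pair (?Y k) (?B k)" if "k \<in> I" for k
        using XA[OF that] by (simp add: simplicial_pair_def topological_pair_polyhedral_product)
    qed blast
    also have "\<dots> \<longleftrightarrow> f \<in> topspace ?P \<and>
        (\<exists>\<tau>\<in>K. \<forall>k\<in>I. support_off (V k) C (f k) \<in> (if k \<in> \<tau> then X k else A k))"
      unfolding topspace_product_topology[of _ I] PiE_iff using YB by blast
    finally show ?thesis .
  qed
  have Z_iff: "flatten I V f \<in> topspace ?Z \<longleftrightarrow>
      flatten I V f \<in> topspace ?Q \<and>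
      (\<exists>\<tau>\<in>K. \<forall>k\<in>I. support_off (V k) C (f k) \<in> (if k \<in> \<tau> then X k else A k))" for f
  proof -
    let ?s = "support_off (\<Union>k\<in>I. V k) C (flatten I V f)"
    have "?s \<subseteq> (\<Union>k\<in>I. V k)"
      by (auto simp: support_off_def)
    then have "?s \<in> polyhedral_product_complex I V K X A \<longleftrightarrow>
        (\<exists>\<tau>\<in>K. \<forall>k\<in>I. support_off (V k) C (f k) \<in> (if k \<in> \<tau> then X k else A k))"
      by (simp add: polyhedral_product_complex_def simplicial_join_def
          support_off_flatten[OF disj])
    then show ?thesis
      using in_topspace_polyhedral_product_iff[OF
          abstract_simplicial_complex_polyhedral_product_complex[OF \<open>finite I\<close> XA] UC]
      by simp
  qed
  have "homeomorphic_map (subtopology ?P (topspace ?W)) (subtopology ?Q (topspace ?Z))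
      (flatten I V)"
    using W_iff Z_iff by (intro homeomorphic_map_subtopologies_alt[OF hom]) blast
  with W Z show ?thesis
    by simp
qed

theorem theorem2p9:
  fixes m :: nat
    and n :: "nat \<Rightarrow> nat"
    and K :: "nat set set"
    and X A :: "nat \<Rightarrow> nat set set"
    and U C :: "nat \<Rightarrow> 'a topology"
    and Y B :: "nat \<Rightarrow> (nat \<Rightarrow> 'a) topology"
  assumes "abstract_simplicial_complex {1..m} K"
    and "\<And>k. k \<in> {1..m} \<Longrightarrow> n k > 0"
    and "\<And>k. k \<in> {1..m} \<Longrightarrow> simplicial_pair (block n k) (X k) (A k)"
    and "\<And>i. i \<in> {1..psum n m} \<Longrightarrow> topological_pair (U i) (C i)"
  defines "Y \<equiv> \<lambda>k. polyhedral_product (block n k) (X k) U C"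
    and "B \<equiv> \<lambda>k. polyhedral_product (block n k) (A k) U C"
  shows "homeomorphic_map
           (polyhedral_product {1..m} K Y B)
           (polyhedral_product {1..psum n m}
              (polyhedral_product_complex {1..m} (block n) K X A) U C)
           (flatten {1..m} (block n))"
  unfolding Y_def B_def Union_block[symmetric]
  using assms(3,4) disjoint_block
  by (intro homeomorphic_map_flatten_polyhedral_product) (simp_all only: Union_block finite_atLeastAtMost)

end
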